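(* Let $X$ be a real Hilbert space and let $T\colon X\to X$ be a linear nonexpansive operator, and set $F := \operatorname{Fix} T$ (which is nonempty). For $\lambda\in\mathbb{R}$ put $T_\lambda := (1-\lambda)\operatorname{Id} + \lambda T$. Let $(\lambda_n)_{n\in\mathbb{N}}$ be a sequence in $[0,1]$ such that $\sum_{n\in\mathbb{N}} (1-\lambda_n)\lambda_n = +\infty$, and let $x_0\in X$. Then the sequence $(x_n)_{n\in\mathbb{N}}$ generated by $$(\forall n\in\mathbb{N})\quad x_{n+1} := T_{\lambda_n}x_n$$ converges strongly (i.e., in norm) to $P_F x_0$.
   Context: $X$ is a real Hilbert space with inner product $\langle\cdot,\cdot\rangle$ and induced norm $\|\cdot\|$. $\operatorname{Id}\colon X\to X$ is the identity operator. $T$ nonexpansive means $\|Tx-Ty\|\le\|x-y\|$ for all $x,y\in X$. $\operatorname{Fix} T=\{x\in X : Tx=x\}$; the standing assumption is $F=\operatorname{Fix}T\neq\varnothing$ (automatic for linear $T$, since $0\in F$). For linear nonexpansive $T$, $F$ is a closed linear subspace of $X$, and $P_F$ denotes the orthogonal projector onto $F$. $\mathbb{N}=\{0,1,2,\dots\}$. *)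

theory Defs
  imports "HOL-Analysis.Analysis"
begin

text \<open>Real Hilbert spaces are types of sort \<open>{real_inner, complete_space}\<close>; no dimension or
  separability restriction is implied by this sort.\<close>

definition nonexpansive :: "('a::real_normed_vector \<Rightarrow> 'a) \<Rightarrow> bool" where
  "nonexpansive T \<longleftrightarrow> (\<forall>x y. norm (T x - T y) \<le> norm (x - y))"

definition Fix :: "('a \<Rightarrow> 'a) \<Rightarrow> 'a set" where
  "Fix T = {x. T x = x}"

definition relaxation :: "('a::real_vector \<Rightarrow> 'a) \<Rightarrow> real \<Rightarrow> 'a \<Rightarrow> 'a" where
  "relaxation T l x = (1 - l) *\<^sub>R x + l *\<^sub>R T x"

text \<open>The orthogonal projector onto a closed linear subspace \<open>F\<close>. The library's
  \<open>closest_point\<close> requires \<open>heine_borel\<close>, i.e. finite dimension, so it is not available here.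
  The description is proper whenever \<open>F\<close> is a closed subspace of a Hilbert space; for other
  sets it may be unspecified.\<close>

definition orth_projector :: "'a::real_inner set \<Rightarrow> 'a \<Rightarrow> 'a" where
  "orth_projector F x = (THE p. p \<in> F \<and> x - p \<in> orthogonal_comp F)"

lemma orth_projector_eqI:
  assumes "subspace F" "p \<in> F" "x - p \<in> orthogonal_comp F"
  shows "orth_projector F x = p"
  unfolding orth_projector_def
proof (rule the_equality)
  show "p \<in> F \<and> x - p \<in> orthogonal_comp F"
    using assms by blast
  fix q assume q: "q \<in> F \<and> x - q \<in> orthogonal_comp F"
  then have "q - p \<in> F"
    using assms subspace_diff by blast
  then have "(q - p) \<bullet> (x - p) = 0" "(q - p) \<bullet> (x - q) = 0"
    using assms(3) q by (auto simp: orthogonal_comp_def orthogonal_def)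
  then have "(q - p) \<bullet> (q - p) = 0"
    by (simp add: inner_diff_right)
  then show "q = p" by simp
qed

end

theory Submission
  imports Defs
begin

text \<open>
  Write \<open>A\<^sub>n\<close> for the composition of the first \<open>n\<close> relaxations, so that \<open>x\<^sub>n = A\<^sub>n x\<^sub>0\<close>, and
  \<open>R\<close> for the range of \<open>Id - T\<close>. Each \<open>A\<^sub>n\<close> is linear, does not increase norms and commutes with \<open>T\<close>.

  The identity for the squared norm of a convex combination shows that a relaxation step with
  parameter \<open>\<lambda>\<close> lowers \<open>\<parallel>z\<parallel>\<^sup>2\<close> by at least \<open>(1 - \<lambda>) \<lambda> \<parallel>z - T z\<parallel>\<^sup>2\<close>. By linearity the residuals
  \<open>z\<^sub>n - T z\<^sub>n\<close> follow the same iteration, so their norms decrease, and divergence of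
  \<open>\<Sum> (1 - \<lambda>\<^sub>n) \<lambda>\<^sub>n\<close> forces them to \<open>0\<close> (\<open>residual_tendsto_zero\<close>). Since
  \<open>A\<^sub>n (y - T y) = A\<^sub>n y - T (A\<^sub>n y)\<close>, this says that \<open>A\<^sub>n\<close> tends to \<open>0\<close> pointwise on \<open>R\<close>.

  This gives strong convergence as follows. All \<open>x\<^sub>n\<close> lie in the affine set \<open>x\<^sub>0 + R\<close>. For every
  \<open>z\<close> in this set, \<open>x\<^sub>n - A\<^sub>n z\<close> tends to \<open>0\<close>, and therefore \<open>lim \<parallel>x\<^sub>n\<parallel> \<le> \<parallel>z\<parallel>\<close>
  (\<open>norm_limit_le_coset\<close>). Thus \<open>(x\<^sub>n)\<close> is a
  norm-minimizing sequence of a convex set, and the parallelogram law makes it a Cauchy sequence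
  (\<open>Cauchy_minimizing_sequence\<close>). Its limit \<open>p\<close> is fixed by \<open>T\<close> because the residuals vanish. Finally \<open>R\<close> is
  orthogonal to \<open>Fix T\<close> (\<open>Fix_orthogonal_residual\<close>), so \<open>x\<^sub>0 - p\<close>, a limit of elements of \<open>R\<close>, is
  orthogonal to \<open>Fix T\<close>, which identifies \<open>p\<close> as the projection.
\<close>

section \<open>Relaxations of a linear nonexpansive operator\<close>

lemma nonexpansive_linear_norm_le:
  assumes "linear T" "nonexpansive T"
  shows "norm (T z) \<le> norm z"
  using assms(2)[unfolded nonexpansive_def, rule_format, of z 0] linear_0[OF assms(1)] by simp

lemma subspace_Fix: "linear T \<Longrightarrow> subspace (Fix T)"
  by (simp add: subspace_def Fix_def linear_0 linear_add linear_scale)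

lemma subspace_range_residual: "linear T \<Longrightarrow> subspace (range (\<lambda>y. y - T y))"
  by (intro linear_subspace_image subspace_UNIV linear_compose_sub linear_id[unfolded id_def])

lemma linear_relaxation: "linear T \<Longrightarrow> linear (relaxation T l)"
  by (rule linearI)
    (simp_all add: relaxation_def linear_add linear_scale scaleR_add_right mult.commute)

lemma relaxation_commute:
  "linear T \<Longrightarrow> T (relaxation T l z) = relaxation T l (T z)"
  by (simp add: relaxation_def linear_add linear_scale)

lemma norm_relaxation_sq:
  fixes z :: "'a::real_inner"
  shows "(norm (relaxation T l z))\<^sup>2
    = (1 - l) * (norm z)\<^sup>2 + l * (norm (T z))\<^sup>2 - (1 - l) * l * (norm (z - T z))\<^sup>2"
  unfolding relaxation_def power2_norm_eq_inner
  by (simp add: inner_add_left inner_add_right inner_diff_left inner_diff_right inner_commute)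
    algebra

text \<open>The loss term quantifies how much a step gains from the displacement of its argument;
  summed along an orbit it is controlled by the initial norm.\<close>

lemma norm_relaxation_sq_le:
  fixes z :: "'a::real_inner"
  assumes "linear T" "nonexpansive T" "l \<in> {0..1}"
  shows "(norm (relaxation T l z))\<^sup>2 \<le> (norm z)\<^sup>2 - (1 - l) * l * (norm (z - T z))\<^sup>2"
proof -
  have "l * (norm (T z))\<^sup>2 \<le> l * (norm z)\<^sup>2"
    using assms nonexpansive_linear_norm_le[OF assms(1,2), of z]
    by (intro mult_left_mono power_mono) auto
  then show ?thesis
    unfolding norm_relaxation_sq by (simp add: algebra_simps)
qed

lemma norm_relaxation_le:
  fixes z :: "'a::real_inner"
  assumes "linear T" "nonexpansive T" "l \<in> {0..1}"
  shows "norm (relaxation T l z) \<le> norm z"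
proof (rule power2_le_imp_le)
  have "0 \<le> (1 - l) * l * (norm (z - T z))\<^sup>2"
    using assms(3) by simp
  then show "(norm (relaxation T l z))\<^sup>2 \<le> (norm z)\<^sup>2"
    using norm_relaxation_sq_le[OF assms, of z] by linarith
qed simp

section \<open>The iteration as a sequence of linear operators\<close>

text \<open>The iteration is needed from starting points other than the given one, as an operator in
  the starting point.\<close>

primrec km_iterate :: "('a::real_vector \<Rightarrow> 'a) \<Rightarrow> (nat \<Rightarrow> real) \<Rightarrow> nat \<Rightarrow> 'a \<Rightarrow> 'a" where
  "km_iterate T lam 0 z = z"
| "km_iterate T lam (Suc n) z = relaxation T (lam n) (km_iterate T lam n z)"

lemma linear_km_iterate:
  assumes "linear T"
  shows "linear (km_iterate T lam n)"
proof (induction n)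
  case 0
  show ?case by (rule linearI) simp_all
next
  case (Suc n)
  show ?case
    using linear_compose[OF Suc linear_relaxation[OF assms, of "lam n"]] by (simp add: o_def)
qed

lemma km_iterate_commute:
  assumes "linear T"
  shows "T (km_iterate T lam n z) = km_iterate T lam n (T z)"
  by (induction n) (simp_all add: relaxation_commute[OF assms])

lemma km_iterate_residual:
  assumes "linear T"
  shows "km_iterate T lam n (z - T z) = km_iterate T lam n z - T (km_iterate T lam n z)"
  by (simp add: km_iterate_commute[OF assms] linear_diff[OF linear_km_iterate[OF assms]])

lemma decseq_norm_km_iterate:
  fixes T :: "'a::real_inner \<Rightarrow> 'a"
  assumes "linear T" "nonexpansive T" "\<And>n. lam n \<in> {0..1}"
  shows "decseq (\<lambda>n. norm (km_iterate T lam n z))"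
  by (rule decseq_SucI) (simp add: norm_relaxation_le[OF assms])

lemma km_iterate_in_coset:
  assumes "linear T"
  shows "km_iterate T lam n z - z \<in> range (\<lambda>y. y - T y)"
proof (induction n)
  case 0
  show ?case using subspace_0[OF subspace_range_residual[OF assms]] by simp
next
  case (Suc n)
  let ?R = "range (\<lambda>y. y - T y)" and ?w = "km_iterate T lam n z"
  have sub: "subspace ?R" by (rule subspace_range_residual[OF assms])
  have "lam n *\<^sub>R (?w - T ?w) \<in> ?R"
    by (rule subspace_scale[OF sub]) simp
  then have "(?w - z) - lam n *\<^sub>R (?w - T ?w) \<in> ?R"
    by (rule subspace_diff[OF sub Suc])
  then show ?case by (simp add: relaxation_def algebra_simps)
qed

section \<open>Asymptotic regularity\<close>

text \<open>The squared residual at step \<open>N\<close> is the smallest so far, so \<open>\<Sum>n<N. (1 - \<lambda>\<^sub>n) \<lambda>\<^sub>n\<close> times it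
  is at most the accumulated loss of squared norm, which never exceeds \<open>\<parallel>z\<parallel>\<^sup>2\<close>.\<close>

lemma residual_tendsto_zero:
  fixes T :: "'a::real_inner \<Rightarrow> 'a"
  assumes lin: "linear T" and nonexp: "nonexpansive T" and lam: "\<And>n. lam n \<in> {0..1}"
    and div: "filterlim (\<lambda>N. \<Sum>n<N. (1 - lam n) * lam n) at_top sequentially"
  shows "(\<lambda>n. km_iterate T lam n (z - T z)) \<longlonglongrightarrow> 0"
proof -
  define r where "r n = (norm (km_iterate T lam n (z - T z)))\<^sup>2" for n
  define S where "S N = (\<Sum>n<N. (1 - lam n) * lam n)" for N
  have r_mono: "r N \<le> r n" if "n \<le> N" for n N
    unfolding r_def
    using decseqD[OF decseq_norm_km_iterate[OF lin nonexp lam] that] by (rule power_mono) simp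
  have loss: "(\<Sum>n<N. (1 - lam n) * lam n * r n) \<le> (norm z)\<^sup>2 - (norm (km_iterate T lam N z))\<^sup>2"
    for N
  proof (induction N)
    case (Suc N)
    then show ?case
      using norm_relaxation_sq_le[OF lin nonexp lam, of N "km_iterate T lam N z"]
      by (simp add: r_def km_iterate_residual[OF lin])
  qed simp
  have bound: "S N * r N \<le> (norm z)\<^sup>2" for N
  proof -
    have "S N * r N \<le> (\<Sum>n<N. (1 - lam n) * lam n * r n)"
      unfolding S_def sum_distrib_right
      using lam by (intro sum_mono mult_left_mono r_mono) auto
    also have "\<dots> \<le> (norm z)\<^sup>2"
      using loss[of N] zero_le_power2[of "norm (km_iterate T lam N z)"] by linarith
    finally show ?thesis .
  qed
  have S_top: "filterlim S at_top sequentially"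
    using div by (simp add: S_def[abs_def])
  have "r \<longlonglongrightarrow> 0"
  proof (rule tendsto_sandwich)
    show "\<forall>\<^sub>F n in sequentially. 0 \<le> r n"
      by (simp add: r_def)
    have "\<forall>\<^sub>F n in sequentially. 0 < S n"
      using S_top by (simp add: filterlim_at_top_dense)
    then show "\<forall>\<^sub>F n in sequentially. r n \<le> (norm z)\<^sup>2 / S n"
      by eventually_elim (use bound in \<open>simp add: field_simps\<close>)
    show "(\<lambda>n. (norm z)\<^sup>2 / S n) \<longlonglongrightarrow> 0"
      by (rule real_tendsto_divide_at_top[OF tendsto_const S_top])
  qed simp
  then have "(\<lambda>n. sqrt (r n)) \<longlonglongrightarrow> sqrt 0"
    by (rule tendsto_real_sqrt)
  then show ?thesis
    by (simp add: r_def tendsto_norm_zero_iff)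
qed

section \<open>Orthogonality of the fixed points to the range of the residual\<close>

text \<open>If the linear term of \<open>t \<mapsto> \<parallel>f + t y\<parallel>\<^sup>2 - \<parallel>T (f + t y)\<parallel>\<^sup>2\<close> did not vanish, this quadratic
  without constant term would change sign at \<open>0\<close>, contradicting nonexpansiveness.\<close>

lemma Fix_orthogonal_residual:
  fixes T :: "'a::real_inner \<Rightarrow> 'a"
  assumes lin: "linear T" and nonexp: "nonexpansive T" and f: "f \<in> Fix T"
  shows "f \<bullet> (y - T y) = 0"
proof (rule ccontr)
  define a where "a = f \<bullet> (y - T y)"
  define b where "b = (norm y)\<^sup>2 - (norm (T y))\<^sup>2"
  assume "f \<bullet> (y - T y) \<noteq> 0"
  then have a: "a \<noteq> 0" by (simp add: a_def)
  have b: "0 \<le> b"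
    unfolding b_def using nonexpansive_linear_norm_le[OF lin nonexp, of y]
    by (simp add: power_mono)
  have quad: "0 \<le> 2 * t * a + t\<^sup>2 * b" for t
  proof -
    have "norm (f + t *\<^sub>R T y) \<le> norm (f + t *\<^sub>R y)"
      using nonexpansive_linear_norm_le[OF lin nonexp, of "f + t *\<^sub>R y"] f
      by (simp add: Fix_def linear_add[OF lin] linear_scale[OF lin])
    then have "(norm (f + t *\<^sub>R T y))\<^sup>2 \<le> (norm (f + t *\<^sub>R y))\<^sup>2"
      by (simp add: power_mono)
    then show ?thesis
      unfolding a_def b_def power2_norm_eq_inner
      by (simp add: inner_add_left inner_add_right inner_diff_right inner_commute
          power2_eq_square algebra_simps)
  qed
  \<comment> \<open>Minimizing over \<open>t\<close> would suggest \<open>t = -a / b\<close>; the denominator \<open>b + 1\<close> also covers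
    \<open>b = 0\<close>.\<close>
  have "2 * (- a / (b + 1)) * a + (- a / (b + 1))\<^sup>2 * b = - (a\<^sup>2 * (b + 2)) / (b + 1)\<^sup>2"
    using b by (simp add: divide_simps power2_eq_square) algebra
  moreover have "- (a\<^sup>2 * (b + 2)) / (b + 1)\<^sup>2 < 0"
    using a b by (simp add: divide_less_0_iff)
  ultimately show False
    using quad[of "- a / (b + 1)"] by linarith
qed

section \<open>Norm minimization and strong convergence\<close>

text \<open>The iterates minimize the norm on the affine set \<open>z + range (Id - T)\<close> in the limit: the
  operators \<open>A\<^sub>n\<close> merge all orbits starting there, and the orbit of \<open>z + v\<close> never leaves the ball
  of radius \<open>\<parallel>z + v\<parallel>\<close>.\<close>

lemma norm_limit_le_coset:
  fixes T :: "'a::real_inner \<Rightarrow> 'a"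
  assumes lin: "linear T" and nonexp: "nonexpansive T" and lam: "\<And>n. lam n \<in> {0..1}"
    and div: "filterlim (\<lambda>N. \<Sum>n<N. (1 - lam n) * lam n) at_top sequentially"
    and lim: "(\<lambda>n. norm (km_iterate T lam n z)) \<longlonglongrightarrow> \<rho>"
    and v: "v \<in> range (\<lambda>y. y - T y)"
  shows "\<rho> \<le> norm (z + v)"
proof -
  obtain y where y: "v = y - T y" using v by blast
  have small: "(\<lambda>n. norm (km_iterate T lam n v)) \<longlonglongrightarrow> 0"
    unfolding y using residual_tendsto_zero[OF lin nonexp lam div] by (rule tendsto_norm_zero)
  have "norm (km_iterate T lam n z) \<le> norm (z + v) + norm (km_iterate T lam n v)" for n
  proof -
    have "km_iterate T lam n z = km_iterate T lam n (z + v) - km_iterate T lam n v"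
      by (simp add: linear_add[OF linear_km_iterate[OF lin]])
    also have "norm \<dots> \<le> norm (km_iterate T lam n (z + v)) + norm (km_iterate T lam n v)"
      by (rule norm_triangle_ineq4)
    also have "norm (km_iterate T lam n (z + v)) \<le> norm (z + v)"
      using decseqD[OF decseq_norm_km_iterate[OF lin nonexp lam], of 0 n] by simp
    finally show ?thesis by simp
  qed
  moreover have "(\<lambda>n. norm (z + v) + norm (km_iterate T lam n v)) \<longlonglongrightarrow> norm (z + v)"
    using tendsto_add[OF tendsto_const small] by simp
  ultimately show ?thesis
    by (intro LIMSEQ_le[OF lim]) auto
qed

text \<open>A norm-minimizing sequence of a convex set is Cauchy: midpoints stay in the set, so the
  parallelogram law bounds the distance of two terms by the excess of their norms.\<close>

lemma Cauchy_minimizing_sequence: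
  fixes x :: "nat \<Rightarrow> 'a::real_inner"
  assumes lim: "(\<lambda>n. norm (x n)) \<longlonglongrightarrow> \<rho>"
    and mid: "\<And>m n. \<rho> \<le> norm ((1/2) *\<^sub>R (x m + x n))"
  shows "Cauchy x"
proof (rule CauchyI)
  fix e :: real
  assume e: "0 < e"
  have "0 \<le> \<rho>"
    using lim by (rule LIMSEQ_le_const) simp
  have "(\<lambda>n. (norm (x n))\<^sup>2) \<longlonglongrightarrow> \<rho>\<^sup>2"
    by (rule tendsto_power[OF lim])
  \<comment> \<open>Two terms contribute twice their excess each, hence the factor \<open>1/4\<close>.\<close>
  moreover have "0 < e\<^sup>2 / 4"
    using e by simp
  ultimately obtain M where M: "\<And>n. M \<le> n \<Longrightarrow> \<bar>(norm (x n))\<^sup>2 - \<rho>\<^sup>2\<bar> < e\<^sup>2 / 4"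
    unfolding LIMSEQ_iff by (metis real_norm_def)
  show "\<exists>M. \<forall>m\<ge>M. \<forall>n\<ge>M. norm (x m - x n) < e"
  proof (intro exI allI impI)
    fix m n
    assume mn: "M \<le> m" "M \<le> n"
    have "\<rho>\<^sup>2 \<le> (norm ((1/2) *\<^sub>R (x m + x n)))\<^sup>2"
      using mid \<open>0 \<le> \<rho>\<close> by (rule power_mono)
    then have "4 * \<rho>\<^sup>2 \<le> (norm (x m + x n))\<^sup>2"
      by (simp add: power_divide)
    moreover have "(norm (x m - x n))\<^sup>2
        = 2 * (norm (x m))\<^sup>2 + 2 * (norm (x n))\<^sup>2 - (norm (x m + x n))\<^sup>2"
      unfolding power2_norm_eq_inner
      by (simp add: inner_add_left inner_add_right inner_diff_left inner_diff_right inner_commute)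
    ultimately have "(norm (x m - x n))\<^sup>2 < e\<^sup>2"
      using M[OF mn(1)] M[OF mn(2)] by linarith
    then show "norm (x m - x n) < e"
      using e by (simp add: power_less_imp_less_base)
  qed
qed

lemma Cauchy_iterates:
  fixes T :: "'a::real_inner \<Rightarrow> 'a"
  assumes lin: "linear T" and nonexp: "nonexpansive T" and lam: "\<And>n. lam n \<in> {0..1}"
    and div: "filterlim (\<lambda>N. \<Sum>n<N. (1 - lam n) * lam n) at_top sequentially"
  shows "Cauchy (\<lambda>n. km_iterate T lam n z)"
proof -
  let ?R = "range (\<lambda>y. y - T y)" and ?x = "\<lambda>n. km_iterate T lam n z"
  have sub: "subspace ?R" by (rule subspace_range_residual[OF lin])
  obtain \<rho> where lim: "(\<lambda>n. norm (?x n)) \<longlonglongrightarrow> \<rho>"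
    using decseq_convergent[OF decseq_norm_km_iterate[where lam = lam, OF lin nonexp lam]]
    by (metis norm_ge_zero)
  show ?thesis
  proof (rule Cauchy_minimizing_sequence[OF lim])
    fix m n
    let ?v = "(1/2) *\<^sub>R ((?x m - z) + (?x n - z))"
    have "?v \<in> ?R"
      by (intro subspace_scale[OF sub] subspace_add[OF sub] km_iterate_in_coset[OF lin])
    then have "\<rho> \<le> norm (z + ?v)"
      by (rule norm_limit_le_coset[OF lin nonexp lam div lim])
    also have "z + ?v = (1/2) *\<^sub>R (?x m + ?x n) + (z - (1/2 + 1/2) *\<^sub>R z)"
      by (simp only: scaleR_add_left scaleR_add_right scaleR_diff_right) (simp add: algebra_simps)
    also have "\<dots> = (1/2) *\<^sub>R (?x m + ?x n)"
      by simp
    finally show "\<rho> \<le> norm ((1/2) *\<^sub>R (?x m + ?x n))" .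
  qed
qed

theorem theorem2p3:
  fixes T :: "'a::{real_inner, complete_space} \<Rightarrow> 'a"
    and lam :: "nat \<Rightarrow> real"
    and x0 :: 'a
    and x :: "nat \<Rightarrow> 'a"
  assumes "linear T"
    and "nonexpansive T"
    and "\<And>n. lam n \<in> {0..1}"
    and "filterlim (\<lambda>N. \<Sum>n<N. (1 - lam n) * lam n) at_top sequentially"
    and "x 0 = x0"
    and "\<And>n. x (Suc n) = relaxation T (lam n) (x n)"
  shows "x \<longlonglongrightarrow> orth_projector (Fix T) x0"
proof -
  have x_eq: "x n = km_iterate T lam n x0" for n
    by (induction n) (simp_all add: assms(5,6))
  have "Cauchy x"
    using Cauchy_iterates[OF assms(1-4), of x0] by (simp add: x_eq[symmetric])
  then obtain p where p: "x \<longlonglongrightarrow> p"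
    using Cauchy_convergent convergent_def by blast
  have "bounded_linear T"
    using nonexpansive_linear_norm_le[OF assms(1,2)]
    by (intro bounded_linear_intro[where K = 1]) (simp_all add: linear_add linear_scale assms(1))
  then have "(\<lambda>n. x n - T (x n)) \<longlonglongrightarrow> p - T p"
    by (intro tendsto_diff p bounded_linear.tendsto[OF _ p])
  moreover have "(\<lambda>n. x n - T (x n)) \<longlonglongrightarrow> 0"
    using residual_tendsto_zero[OF assms(1-4), of x0]
    by (simp add: km_iterate_residual[OF assms(1)] x_eq)
  ultimately have "p - T p = 0"
    by (rule LIMSEQ_unique)
  then have p_Fix: "p \<in> Fix T"
    by (simp add: Fix_def)
  have "f \<bullet> (x0 - p) = 0" if f: "f \<in> Fix T" for f
  proof -
    have "f \<bullet> (x n - x0) = 0" for n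
      using km_iterate_in_coset[OF assms(1), of lam n x0] Fix_orthogonal_residual[OF assms(1,2) f]
      by (auto simp: x_eq)
    then have "f \<bullet> (x0 - x n) = 0" for n
      by (simp add: inner_diff_right)
    moreover have "(\<lambda>n. f \<bullet> (x0 - x n)) \<longlonglongrightarrow> f \<bullet> (x0 - p)"
      by (intro tendsto_intros p)
    ultimately show ?thesis
      by (simp add: LIMSEQ_const_iff)
  qed
  then have "x0 - p \<in> orthogonal_comp (Fix T)"
    by (simp add: orthogonal_comp_def orthogonal_def)
  then have "orth_projector (Fix T) x0 = p"
    by (rule orth_projector_eqI[OF subspace_Fix[OF assms(1)] p_Fix])
  then show ?thesis
    using p by simp
qed

end
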